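(* Let $0<p<1$, $0<q<1$, $c\ge0$, and consider the Markov decision process with state process $S^\pi(t)$ and actions $a^\pi(t)$, $t=1,2,3,\dots$, described in the context, started from a fixed initial state $S^\pi(1)$ of age $1$. Then there exists a switching type policy that is optimal for $$\limsup_{T\to\infty}\frac1T\,\mathbb{E}_\pi\left[\sum_{t=1}^{T}C\bigl(S^\pi(t),a^\pi(t)\bigr)\right],$$ i.e. that minimizes this quantity over the set $\Pi$ of all causal policies.
   Context: State space: $\mathcal{S}=\{(v,\lambda,b): v\in\{1,2,3,\dots\},\ \lambda,b\in\{0,1\}\}$, where $v$ is the age of the information at a user, $\lambda=1$ iff a fresh update packet is available at the base station (BS), and $b=1$ iff a packet is stored in the BS's unit-size buffer. Actions: $a=1$ (store the fresh packet), $a=0$ (do not store). Transition probabilities $P_a(S,S')$. Write $\rho(1)=p$, $\rho(0)=1-p$. (i) From $S=(v,1,b)$ with $b\in\{0,1\}$, under action $a$: to $(1,\lambda',a)$ with probability $q\,\rho(\lambda')$, and to $(v+1,\lambda',a)$ with probability $(1-q)\rho(\lambda')$, for $\lambda'\in\{0,1\}$. (ii) From $S=(v,0,0)$, under either action: to $(v+1,\lambda',0)$ with probability $\rho(\lambda')$. (iii) From $S=(v,0,1)$, under either action: to $(2,\lambda',0)$ with probability $q\,\rho(\lambda')$ and to $(v+1,\lambda',0)$ with probability $(1-q)\rho(\lambda')$ (when $v=1$ the two target states coincide and the probabilities are added). All other transition probabilities are $0$. One-step cost: $C(S,a)=a\,c+\sum_{S'=(v',\lambda',b')\in\mathcal{S}}v'\,P_a(S,S')$,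 where $c$ is the storage cost. Policies. A causal policy chooses (possibly at random) the action $a^\pi(t)$ on the basis of current and past information only (the states up to time $t$ and the actions before time $t$); $\Pi$ is the set of causal policies. A switching type (switch based) policy is a stationary policy, i.e. a map $f:\mathcal{S}\to\{0,1\}$ with $a(t)=f(S(t))$ for all $t$, such that whenever $f(S)=1$ (it stores at state $S$) then $f(S')=1$ for every state $S'$ with $S'\ge S$ componentwise. *)

theory Defs
  imports "HOL-Probability.Probability"
begin

text \<open>A state is \<open>(v, l, b)\<close>: age \<open>v\<close>, fresh-packet indicator \<open>l\<close>, buffer indicator \<open>b\<close>.
  Only states with \<open>v \<ge> 1\<close> belong to the model.\<close>

type_synonym state = "nat \<times> bool \<times> bool"
type_synonym action = bool

definition state_space :: "state set" where
  "state_space = {(v, l, b). v \<ge> 1}"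

fun trans_pmf :: "real \<Rightarrow> real \<Rightarrow> state \<Rightarrow> action \<Rightarrow> state pmf" where
  "trans_pmf p q (v, True, b) a =
     do { l' \<leftarrow> bernoulli_pmf p; d \<leftarrow> bernoulli_pmf q;
          return_pmf (if d then 1 else v + 1, l', a) }"
| "trans_pmf p q (v, False, False) a =
     do { l' \<leftarrow> bernoulli_pmf p; return_pmf (v + 1, l', False) }"
| "trans_pmf p q (v, False, True) a =
     do { l' \<leftarrow> bernoulli_pmf p; d \<leftarrow> bernoulli_pmf q;
          return_pmf (if d then 2 else v + 1, l', False) }"

lemma pmf_trans_pmf:
  assumes "0 \<le> p" "p \<le> 1" "0 \<le> q" "q \<le> 1"
  defines "\<rho> \<equiv> \<lambda>l::bool. if l then p else 1 - p"
  shows "pmf (trans_pmf p q (v, True, b) a) (v', l', b') =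
           (if b' = a then (of_bool (v' = 1) * q + of_bool (v' = v + 1) * (1 - q)) * \<rho> l' else 0)"
    and "pmf (trans_pmf p q (v, False, False) a) (v', l', b') =
           (if v' = v + 1 \<and> \<not> b' then \<rho> l' else 0)"
    and "pmf (trans_pmf p q (v, False, True) a) (v', l', b') =
           (if \<not> b' then (of_bool (v' = 2) * q + of_bool (v' = v + 1) * (1 - q)) * \<rho> l' else 0)"
  using assms by (auto simp: pmf_bind indicator_def \<rho>_def algebra_simps)

definition cost :: "real \<Rightarrow> real \<Rightarrow> real \<Rightarrow> state \<Rightarrow> action \<Rightarrow> real" where
  "cost p q c S a =
     of_bool a * c + (\<Sum>\<^sub>\<infinity>S'\<in>state_space. real (fst S') * pmf (trans_pmf p q S a) S')"

text \<open>A causal policy maps the past state-action pairs (oldest first) and the current state to a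
  distribution over actions.\<close>

type_synonym history = "(state \<times> action) list"
type_synonym policy = "history \<Rightarrow> state \<Rightarrow> action pmf"

text \<open>\<open>process_pmf p q \<pi> S\<^sub>1 T\<close> is the joint law of \<open>([(S(1), a(1)), \<dots>, (S(T), a(T))], S(T + 1))\<close>.\<close>

primrec process_pmf :: "real \<Rightarrow> real \<Rightarrow> policy \<Rightarrow> state \<Rightarrow> nat \<Rightarrow> (history \<times> state) pmf" where
  "process_pmf p q \<pi> S\<^sub>1 0 = return_pmf ([], S\<^sub>1)"
| "process_pmf p q \<pi> S\<^sub>1 (Suc T) =
     do { (h, S) \<leftarrow> process_pmf p q \<pi> S\<^sub>1 T;
          a \<leftarrow> \<pi> h S;
          S' \<leftarrow> trans_pmf p q S a;
          return_pmf (h @ [(S, a)], S') }"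

definition expected_total_cost :: "real \<Rightarrow> real \<Rightarrow> real \<Rightarrow> policy \<Rightarrow> state \<Rightarrow> nat \<Rightarrow> real" where
  "expected_total_cost p q c \<pi> S\<^sub>1 T =
     measure_pmf.expectation (process_pmf p q \<pi> S\<^sub>1 T) (\<lambda>(h, S'). \<Sum>(S, a)\<leftarrow>h. cost p q c S a)"

definition average_cost :: "real \<Rightarrow> real \<Rightarrow> real \<Rightarrow> policy \<Rightarrow> state \<Rightarrow> ereal" where
  "average_cost p q c \<pi> S\<^sub>1 =
     limsup (\<lambda>T. ereal (1 / real T * expected_total_cost p q c \<pi> S\<^sub>1 T))"

definition stationary :: "(state \<Rightarrow> action) \<Rightarrow> policy" where
  "stationary f = (\<lambda>h S. return_pmf (f S))"

definition switching_type :: "policy \<Rightarrow> bool" where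
  "switching_type \<pi> \<longleftrightarrow> (\<exists>f. \<pi> = stationary f \<and>
     (\<forall>(v, l, b) \<in> state_space. \<forall>(v', l', b') \<in> state_space.
        f (v, l, b) \<and> v \<le> v' \<and> l \<le> l' \<and> b \<le> b' \<longrightarrow> f (v', l', b')))"

definition optimal_policy :: "real \<Rightarrow> real \<Rightarrow> real \<Rightarrow> state \<Rightarrow> policy \<Rightarrow> bool" where
  "optimal_policy p q c S\<^sub>1 \<pi> \<longleftrightarrow>
     (\<forall>\<pi>'. average_cost p q c \<pi> S\<^sub>1 \<le> average_cost p q c \<pi>' S\<^sub>1)"

end

theory Submission imports Defs begin

text \<open>Every step delivers a fresh packet with probability \<open>p * q\<close>, whatever the policy did
  before, and in a state of age 1 the buffer content is worthless. Removing these deliveries turns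
  the average-cost problem into a total-cost problem that is killed at rate \<open>p * q\<close>. Value
  iteration for the latter increases to a fixed point \<open>F b v\<close> of linear growth and nondecreasing
  in \<open>v\<close>; it yields a solution of the average-cost optimality equation with gain
  \<open>p * q * F False 1\<close>. Storing pays off iff \<open>F False (v + 1) - F True (v + 1)\<close> is large,
  and this difference is nondecreasing in \<open>v\<close>. A Lyapunov function bounds the expected age
  uniformly in time and in the policy, which makes the verification argument work.\<close>

section \<open>Expectations over finitely supported laws\<close>

lemma expectation_bind_finite:
  fixes g :: "'b \<Rightarrow> real"
  assumes "finite (set_pmf M)" "\<And>x. finite (set_pmf (f x))"
  shows "measure_pmf.expectation (bind_pmf M f) g
    = measure_pmf.expectation M (\<lambda>x. measure_pmf.expectation (f x) g)"
  using assms by (subst pmf_expectation_bind[of "set_pmf M"])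
    (auto simp: integral_measure_pmf[of "set_pmf M"])

lemma expectation_mono_finite:
  fixes f g :: "'a \<Rightarrow> real"
  assumes "finite (set_pmf M)" "\<And>x. x \<in> set_pmf M \<Longrightarrow> f x \<le> g x"
  shows "measure_pmf.expectation M f \<le> measure_pmf.expectation M g"
  using assms by (intro integral_mono_AE)
    (auto simp: integrable_measure_pmf_finite AE_measure_pmf_iff)

lemma finite_set_trans_pmf: "finite (set_pmf (trans_pmf p q S a))"
proof -
  obtain v l b where S: "S = (v, l, b)" by (cases S)
  show ?thesis unfolding S by (cases l; cases b) auto
qed

lemma set_trans_pmf_subset: "set_pmf (trans_pmf p q S a) \<subseteq> state_space"
proof -
  obtain v l b where S: "S = (v, l, b)" by (cases S)
  show ?thesis unfolding S state_space_def by (cases l; cases b) auto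
qed

lemma finite_set_process_pmf: "finite (set_pmf (process_pmf p q \<pi> S T))"
proof (induction T)
  case (Suc T)
  then show ?case by (auto simp: finite_set_trans_pmf)
qed auto

text \<open>Transitions have finite support inside \<open>state_space\<close>, so the infinite sum
  is an ordinary mean.\<close>

lemma cost_eq_expectation:
  "cost p q c S a
    = of_bool a * c + measure_pmf.expectation (trans_pmf p q S a) (\<lambda>S'. real (fst S'))"
proof -
  let ?M = "trans_pmf p q S a"
  have "(\<Sum>\<^sub>\<infinity>S'\<in>state_space. real (fst S') * pmf ?M S')
      = (\<Sum>\<^sub>\<infinity>S'\<in>set_pmf ?M. real (fst S') * pmf ?M S')"
    using set_trans_pmf_subset[of p q S a]
    by (intro infsum_cong_neutral) (auto simp: set_pmf_iff)
  also have "\<dots> = measure_pmf.expectation ?M (\<lambda>S'. real (fst S'))"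
    using finite_set_trans_pmf[of p q S a]
    by (subst integral_measure_pmf[of "set_pmf ?M"]) (auto simp: mult.commute set_pmf_iff)
  finally show ?thesis unfolding cost_def by simp
qed

text \<open>Tower property: conditioning on the history isolates the last action and transition. The
  inductions over the horizon rest on it.\<close>

lemma expectation_process_pmf_Suc:
  fixes G :: "history \<Rightarrow> state \<Rightarrow> real"
  shows "measure_pmf.expectation (process_pmf p q \<pi> S\<^sub>1 (Suc T)) (\<lambda>(h, S). G h S)
   = measure_pmf.expectation (process_pmf p q \<pi> S\<^sub>1 T) (\<lambda>(h, S).
       measure_pmf.expectation (\<pi> h S) (\<lambda>a.
         measure_pmf.expectation (trans_pmf p q S a) (G (h @ [(S, a)]))))"
  by (simp add: expectation_bind_finite finite_set_process_pmf finite_set_trans_pmf split_def)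

section \<open>One-step means and the killed Bellman operator\<close>

locale storage_mdp =
  fixes p q c :: real
  assumes p: "0 < p" "p < 1" and q: "0 < q" "q < 1" and c: "0 \<le> c"
begin

lemma expectation_trans_pmf:
  fixes G :: "state \<Rightarrow> real"
  defines "m \<equiv> \<lambda>v b. p * G (v, True, b) + (1 - p) * G (v, False, b)"
  shows "measure_pmf.expectation (trans_pmf p q (v, True, b) a) G
      = q * m 1 a + (1 - q) * m (v + 1) a"
    and "measure_pmf.expectation (trans_pmf p q (v, False, False) a) G = m (v + 1) False"
    and "measure_pmf.expectation (trans_pmf p q (v, False, True) a) G
      = q * m 2 False + (1 - q) * m (v + 1) False"
  using p q by (simp_all add: expectation_bind_finite m_def algebra_simps)

declare trans_pmf.simps [simp del]

lemma cost_simps: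
  "cost p q c (v, True, b) a = of_bool a * c + q + (1 - q) * (real v + 1)"
  "cost p q c (v, False, False) a = of_bool a * c + (real v + 1)"
  "cost p q c (v, False, True) a = of_bool a * c + 2 * q + (1 - q) * (real v + 1)"
  unfolding cost_eq_expectation expectation_trans_pmf by (simp_all add: algebra_simps)

text \<open>\<open>F b v\<close> is the cost from an age \<open>v\<close> and buffer \<open>b\<close> whose fresh-packet indicator has not been
  drawn yet, including \<open>v\<close> itself. The minimum omits the delivery branch, which is killed.\<close>

definition bellman :: "(bool \<Rightarrow> nat \<Rightarrow> real) \<Rightarrow> bool \<Rightarrow> nat \<Rightarrow> real" where
  "bellman F b v = real v
     + (1 - p) * (if b then q * F False 2 + (1 - q) * F False (v + 1) else F False (v + 1))
     + p * min ((1 - q) * F False (v + 1)) (c + (1 - q) * F True (v + 1))"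

lemma bellman_mono:
  assumes "\<And>b v. F b v \<le> G b v"
  shows "bellman F b v \<le> bellman G b v"
  unfolding bellman_def using p q assms
  by (cases b) (auto intro!: add_mono mult_left_mono min.mono)

lemma mono_bellman:
  assumes "\<And>b. mono (F b)"
  shows "mono (bellman F b)"
proof (rule monoI)
  fix u v :: nat assume uv: "u \<le> v"
  then have "F b (u + 1) \<le> F b (v + 1)" for b using monoD[OF assms, of "u + 1" "v + 1"] by simp
  then show "bellman F b u \<le> bellman F b v"
    unfolding bellman_def using p q uv
    by (cases b) (auto intro!: add_mono mult_left_mono min.mono)
qed

text \<open>The surviving branches carry total mass at most \<open>1 - p * q\<close>, so the slope
  \<open>1 / (p * q)\<close> reproduces itself; the constant term pays for the growth of the
  age.\<close>

lemma bellman_linear_bound: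
  assumes F: "\<And>b v. F b v \<le> 2 / (p * q)\<^sup>2 + real v / (p * q)"
  shows "bellman F b v \<le> 2 / (p * q)\<^sup>2 + real v / (p * q)"
proof -
  define r where "r = p * q"
  have r: "0 < r" "r \<le> 1" unfolding r_def using p q by (auto intro: mult_le_one)
  \<comment> \<open>The claimed bound at age \<open>v + 2\<close>, which dominates both successor
    ages \<open>v + 1\<close> and 2, also for \<open>v = 0\<close>.\<close>
  define X where "X = 2 / r\<^sup>2 + (real v + 2) / r"
  have FX: "F False (v + 1) \<le> X" "F False 2 \<le> X"
    using F[of False "v + 1"] F[of False 2] r unfolding r_def[symmetric] X_def
    by (auto elim!: order_trans intro!: divide_right_mono)
  have "(if b then q * F False 2 + (1 - q) * F False (v + 1) else F False (v + 1)) \<le> X"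
  proof (cases b)
    case True
    have "q * F False 2 + (1 - q) * F False (v + 1) \<le> q * X + (1 - q) * X"
      using FX q by (intro add_mono mult_left_mono) auto
    then show ?thesis using True by (simp add: algebra_simps)
  qed (use FX in auto)
  moreover have "min ((1 - q) * F False (v + 1)) (c + (1 - q) * F True (v + 1)) \<le> (1 - q) * X"
    using FX q by (intro min.coboundedI1 mult_left_mono) auto
  ultimately have "bellman F b v \<le> real v + (1 - p) * X + p * ((1 - q) * X)"
    unfolding bellman_def using p by (intro add_mono mult_left_mono) auto
  also have "\<dots> = real v + (1 - r) * X" unfolding r_def by (simp add: algebra_simps)
  also have "\<dots> = 2 / r\<^sup>2 + real v / r - 2"
    unfolding X_def using r by (simp add: field_simps power2_eq_square)
  finally show ?thesis unfolding r_def by simp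
qed

text \<open>Value iteration from 0 increases because costs are nonnegative, and the linear bound
  caps it, so it converges pointwise; monotonicity in the age survives the limit.\<close>

lemma bellman_fixed_point:
  obtains F where "\<And>b v. bellman F b v = F b v" "\<And>b. mono (F b)" "\<And>b v. 0 \<le> F b v"
    "\<And>b v. F b v \<le> 2 / (p * q)\<^sup>2 + real v / (p * q)"
proof -
  define V where "V n = (bellman ^^ n) (\<lambda>_ _. 0)" for n
  have V_0: "V 0 b v = 0" and V_Suc: "V (Suc n) = bellman (V n)" for n b v
    by (simp_all add: V_def)
  have step: "V n b v \<le> V (Suc n) b v" for n b v
  proof (induction n arbitrary: b v)
    case 0
    show ?case unfolding V_Suc bellman_def V_0 using p q c by simp
  next
    case (Suc n)
    then show ?case unfolding V_Suc[of "Suc n"] by (subst V_Suc) (rule bellman_mono)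
  qed
  have inc: "incseq (\<lambda>n. V n b v)" for b v by (intro incseq_SucI step)
  have bound: "V n b v \<le> 2 / (p * q)\<^sup>2 + real v / (p * q)" for n b v
  proof (induction n arbitrary: b v)
    case 0
    then show ?case using p q by (simp add: V_0)
  next
    case (Suc n)
    then show ?case unfolding V_Suc by (rule bellman_linear_bound)
  qed
  have mono_V: "mono (V n b)" for n b
  proof (induction n arbitrary: b)
    case 0
    then show ?case by (simp add: V_0 mono_def)
  next
    case (Suc n)
    then show ?case unfolding V_Suc by (rule mono_bellman)
  qed
  have "\<exists>l. (\<lambda>n. V n b v) \<longlonglongrightarrow> l" for b v
    using incseq_convergent[OF inc[of b v]] bound[of _ b v] by metis
  then obtain F where F: "(\<lambda>n. V n b v) \<longlonglongrightarrow> F b v" for b v by metis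
  show thesis
  proof
    fix b v
    \<comment> \<open>For fixed \<open>b\<close> and \<open>v\<close> the operator reads finitely
      many values, so pointwise convergence passes through it.\<close>
    have "(\<lambda>n. bellman (V n) b v) \<longlonglongrightarrow> bellman F b v"
      unfolding bellman_def by (cases b) (auto intro!: tendsto_intros F)
    moreover have "(\<lambda>n. bellman (V n) b v) \<longlonglongrightarrow> F b v"
      using LIMSEQ_Suc[OF F[of b v]] unfolding V_Suc .
    ultimately show "bellman F b v = F b v" by (rule LIMSEQ_unique)
    show "mono (F b)"
      using mono_V by (intro monoI LIMSEQ_le[OF F F]) (auto dest: monoD)
    show "0 \<le> F b v"
      using incseq_le[OF inc[of b v] F[of b v], of 0] by (simp add: V_0)
    show "F b v \<le> 2 / (p * q)\<^sup>2 + real v / (p * q)"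
      using bound by (intro LIMSEQ_le_const2[OF F]) auto
  qed
qed

section \<open>Relative values and the greedy policy\<close>

text \<open>The killed branch returns as \<open>q * F False 1\<close>. The current age is left out
  because \<open>cost\<close> charges the age reached after the step.\<close>

fun rel_value :: "(bool \<Rightarrow> nat \<Rightarrow> real) \<Rightarrow> state \<Rightarrow> real" where
  "rel_value F (v, True, b) = q * F False 1
     + min ((1 - q) * F False (v + 1)) (c + (1 - q) * F True (v + 1))"
| "rel_value F (v, False, False) = F False (v + 1)"
| "rel_value F (v, False, True) = q * F False 2 + (1 - q) * F False (v + 1)"

fun q_value :: "(bool \<Rightarrow> nat \<Rightarrow> real) \<Rightarrow> state \<Rightarrow> action \<Rightarrow> real" where
  "q_value F (v, True, b) a = q * F False 1 + of_bool a * c + (1 - q) * F a (v + 1)"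
| "q_value F (v, False, b) a = rel_value F (v, False, b) + of_bool a * c"

text \<open>Greedy for \<open>q_value\<close>, with ties resolved towards storing when a fresh
  packet is present. Without one, storing costs \<open>c\<close> and changes no transition.\<close>

definition store :: "(bool \<Rightarrow> nat \<Rightarrow> real) \<Rightarrow> state \<Rightarrow> action" where
  "store F = (\<lambda>(v, l, b). l \<and> c + (1 - q) * F True (v + 1) \<le> (1 - q) * F False (v + 1))"


lemma rel_value_le_q_value: "rel_value F S \<le> q_value F S a"
proof -
  obtain v l b where S: "S = (v, l, b)" by (cases S)
  show ?thesis unfolding S using c by (cases l; cases b; cases a) auto
qed

lemma q_value_store: "q_value F S (store F S) = rel_value F S"
proof -
  obtain v l b where S: "S = (v, l, b)" by (cases S)
  show ?thesis unfolding S store_def by (cases l) auto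
qed

section \<open>A uniform bound on the expected age\<close>

text \<open>With a fresh packet this is the mean next age; otherwise it ignores the buffer.
  Averaging over the fresh-packet indicator gives \<open>(1 - p * q) * v + 1\<close>, a contraction
  in the age.\<close>

fun lyapunov :: "state \<Rightarrow> real" where
  "lyapunov (v, True, b) = q + (1 - q) * (real v + 1)"
| "lyapunov (v, False, b) = real v + 1"

lemma lyapunov_drift:
  "measure_pmf.expectation (trans_pmf p q S a) lyapunov \<le> (1 - p * q) * lyapunov S + 2"
proof -
  obtain v l b where S: "S = (v, l, b)" by (cases S)
  have pq: "0 < p * q" "p * q < 1"
    using p q mult_strict_mono[of p 1 q 1] by auto
  have mean: "p * lyapunov (u, True, b') + (1 - p) * lyapunov (u, False, b')
      = (1 - p * q) * real u + 1" for u b'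
    by (simp add: algebra_simps)
  show ?thesis
  proof (cases l)
    case True
    then show ?thesis
      unfolding S by (simp add: expectation_trans_pmf mean algebra_simps)
  next
    case l: False
    show ?thesis
    proof (cases b)
      case False
      then show ?thesis
        unfolding S using l by (simp add: expectation_trans_pmf mean algebra_simps)
    next
      case True
      have "measure_pmf.expectation (trans_pmf p q S a) lyapunov
          = (1 - p * q) * (2 * q + (1 - q) * (real v + 1)) + 1"
        unfolding S using l True
        by (simp only: expectation_trans_pmf mean) (simp add: algebra_simps)
      \<comment> \<open>The lemma ranges over all triples, and \<open>v + 2\<close> dominates 2 even
        at \<open>v = 0\<close>. The constant 2 of the drift absorbs the excess over
        \<open>v + 1\<close>.\<close>
      also have "\<dots> \<le> (1 - p * q) * (real v + 2) + 1"
      proof -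
        have "2 * q + (1 - q) * (real v + 1) \<le> q * (real v + 2) + (1 - q) * (real v + 2)"
          using q by (intro add_mono) auto
        then show ?thesis using pq
          by (intro add_right_mono mult_left_mono) (auto simp: algebra_simps)
      qed
      also have "\<dots> \<le> (1 - p * q) * lyapunov S + 2"
        unfolding S using l True pq by (simp add: algebra_simps)
      finally show ?thesis .
    qed
  qed
qed

text \<open>The map sending \<open>x\<close> to \<open>(1 - p * q) * x + 2\<close> has fixed point
  \<open>2 / (p * q)\<close>, so no level above that point is ever exceeded once it bounds the
  start.\<close>

lemma expectation_lyapunov_bound:
  "measure_pmf.expectation (process_pmf p q \<pi> S\<^sub>1 T) (\<lambda>(h, S). lyapunov S)
     \<le> max (lyapunov S\<^sub>1) (2 / (p * q))"
proof (induction T)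
  case (Suc T)
  define K where "K = max (lyapunov S\<^sub>1) (2 / (p * q))"
  have pq: "0 < p * q" "p * q < 1"
    using p q mult_strict_mono[of p 1 q 1] by auto
  let ?P = "process_pmf p q \<pi> S\<^sub>1"
  note int = integrable_measure_pmf_finite[OF finite_set_process_pmf]
  have "measure_pmf.expectation (?P (Suc T)) (\<lambda>(h, S). lyapunov S)
      \<le> measure_pmf.expectation (?P T) (\<lambda>(h, S). (1 - p * q) * lyapunov S + 2)"
    unfolding expectation_process_pmf_Suc
  proof (rule expectation_mono_finite[OF finite_set_process_pmf], clarify)
    fix h v l b
    have "measure_pmf.expectation (\<pi> h (v, l, b))
          (\<lambda>a. measure_pmf.expectation (trans_pmf p q (v, l, b) a) lyapunov)
        \<le> measure_pmf.expectation (\<pi> h (v, l, b))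
          (\<lambda>a. (1 - p * q) * lyapunov (v, l, b) + 2)"
      by (rule expectation_mono_finite[OF finite lyapunov_drift])
    then show "measure_pmf.expectation (\<pi> h (v, l, b))
          (\<lambda>a. measure_pmf.expectation (trans_pmf p q (v, l, b) a) lyapunov)
        \<le> (1 - p * q) * lyapunov (v, l, b) + 2" by simp
  qed
  also have "\<dots> = (1 - p * q) * measure_pmf.expectation (?P T) (\<lambda>(h, S). lyapunov S) + 2"
    by (simp add: split_def int)
  also have "\<dots> \<le> (1 - p * q) * K + 2"
    using Suc pq unfolding K_def by (intro add_right_mono mult_left_mono) auto
  also have "\<dots> \<le> K"
  proof -
    have "p * q * (2 / (p * q)) \<le> p * q * K"
      unfolding K_def using pq by (intro mult_left_mono) auto
    then show ?thesis using pq p q by (simp add: algebra_simps)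
  qed
  finally show ?case unfolding K_def .
qed auto

end

section \<open>The average-cost optimality equation\<close>

locale bellman_solution = storage_mdp +
  fixes F :: "bool \<Rightarrow> nat \<Rightarrow> real"
  assumes fixed_point: "\<And>b v. bellman F b v = F b v"
    and mono_F: "\<And>b. mono (F b)"
    and F_nonneg: "\<And>b v. 0 \<le> F b v"
    and F_le: "\<And>b v. F b v \<le> 2 / (p * q)\<^sup>2 + real v / (p * q)"
begin

text \<open>Renewal-reward ratio: a cycle between fresh deliveries costs \<open>F False 1\<close>
  and lasts \<open>1 / (p * q)\<close> steps on average.\<close>

definition gain :: real where
  "gain = p * q * F False 1"

text \<open>The two Bellman equations differ only without a fresh packet, where a buffered one
  replaces age \<open>v + 1\<close> by 2 with probability \<open>q\<close>. The right-hand side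
  inherits monotonicity in \<open>v\<close> from \<open>mono_F\<close>.\<close>

lemma buffer_gain: "F False v - F True v = (1 - p) * q * (F False (v + 1) - F False 2)"
  unfolding fixed_point[of False v, symmetric] fixed_point[of True v, symmetric]
  by (simp add: bellman_def algebra_simps)

lemma F_age_1: "F b 1 = F False 1"
  using buffer_gain[of 1] by (cases b) (auto simp: numeral_2_eq_2)

lemma rel_value_mean:
  "p * rel_value F (v, True, b) + (1 - p) * rel_value F (v, False, b) = F b v - real v + gain"
  unfolding fixed_point[of b v, symmetric]
  by (cases b) (simp_all add: bellman_def gain_def algebra_simps)

text \<open>The mean age in \<open>cost\<close> cancels the age subtracted in
  \<open>rel_value_mean\<close>. After a fresh delivery, \<open>F_age_1\<close> makes the value
  independent of what was stored.\<close>

lemma optimality_equation: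
  "cost p q c S a + measure_pmf.expectation (trans_pmf p q S a) (rel_value F)
    = q_value F S a + gain"
proof -
  obtain v l b where S: "S = (v, l, b)" by (cases S)
  show ?thesis unfolding S
    using F_age_1[of a]
    by (cases l; cases b)
      (simp_all only: cost_simps expectation_trans_pmf rel_value_mean,
       simp_all add: algebra_simps)
qed

section \<open>Verification over finite horizons\<close>

lemma expectation_cost_to_go_Suc:
  "measure_pmf.expectation (process_pmf p q \<pi> S\<^sub>1 (Suc T))
     (\<lambda>(h, S). (\<Sum>(S, a)\<leftarrow>h. cost p q c S a) + rel_value F S)
   = measure_pmf.expectation (process_pmf p q \<pi> S\<^sub>1 T)
     (\<lambda>(h, S). (\<Sum>(S, a)\<leftarrow>h. cost p q c S a) + gain
        + measure_pmf.expectation (\<pi> h S) (q_value F S))"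
proof -
  have "measure_pmf.expectation (trans_pmf p q S a)
      (\<lambda>S'. (\<Sum>(S, a)\<leftarrow>h @ [(S, a)]. cost p q c S a) + rel_value F S')
    = (\<Sum>(S, a)\<leftarrow>h. cost p q c S a) + gain + q_value F S a" for h S a
    using optimality_equation[of S a]
    by (simp add: integrable_measure_pmf_finite finite_set_trans_pmf)
  then show ?thesis
    unfolding expectation_process_pmf_Suc
    by (simp add: integrable_measure_pmf_finite)
qed

text \<open>Each step adds at least \<open>gain\<close> in the mean, whatever the policy, because
  \<open>q_value\<close> never falls below \<open>rel_value\<close>.\<close>

lemma cost_to_go_lower_bound:
  "real T * gain + rel_value F S\<^sub>1 \<le> measure_pmf.expectation (process_pmf p q \<pi> S\<^sub>1 T)
     (\<lambda>(h, S). (\<Sum>(S, a)\<leftarrow>h. cost p q c S a) + rel_value F S)"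
proof (induction T)
  case (Suc T)
  let ?P = "process_pmf p q \<pi> S\<^sub>1"
  have q_value_ge: "rel_value F S \<le> measure_pmf.expectation (\<pi> h S) (q_value F S)" for h S
    using expectation_mono_finite[OF finite, of "\<pi> h S" "\<lambda>_. rel_value F S" "q_value F S"]
    by (simp add: rel_value_le_q_value)
  have "real (Suc T) * gain + rel_value F S\<^sub>1
      \<le> measure_pmf.expectation (?P T)
          (\<lambda>(h, S). (\<Sum>(S, a)\<leftarrow>h. cost p q c S a) + rel_value F S) + gain"
    using Suc by (simp add: algebra_simps)
  also have "\<dots> = measure_pmf.expectation (?P T)
      (\<lambda>(h, S). (\<Sum>(S, a)\<leftarrow>h. cost p q c S a) + gain + rel_value F S)"
    by (simp add: split_def integrable_measure_pmf_finite finite_set_process_pmf)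
  also have "\<dots> \<le> measure_pmf.expectation (?P (Suc T))
      (\<lambda>(h, S). (\<Sum>(S, a)\<leftarrow>h. cost p q c S a) + rel_value F S)"
    unfolding expectation_cost_to_go_Suc
    by (rule expectation_mono_finite[OF finite_set_process_pmf]) (auto intro: q_value_ge)
  finally show ?case .
qed auto

text \<open>The greedy action attains the minimum, so each step adds exactly
  \<open>gain\<close>.\<close>

lemma cost_to_go_stationary_store:
  "measure_pmf.expectation (process_pmf p q (stationary (store F)) S\<^sub>1 T)
     (\<lambda>(h, S). (\<Sum>(S, a)\<leftarrow>h. cost p q c S a) + rel_value F S)
   = real T * gain + rel_value F S\<^sub>1"
proof (induction T)
  case (Suc T)
  let ?P = "process_pmf p q (stationary (store F)) S\<^sub>1"
  have "measure_pmf.expectation (?P (Suc T))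
      (\<lambda>(h, S). (\<Sum>(S, a)\<leftarrow>h. cost p q c S a) + rel_value F S)
    = measure_pmf.expectation (?P T)
      (\<lambda>(h, S). ((\<Sum>(S, a)\<leftarrow>h. cost p q c S a) + rel_value F S) + gain)"
    unfolding expectation_cost_to_go_Suc
    by (simp add: stationary_def q_value_store algebra_simps)
  also have "\<dots> = real (Suc T) * gain + rel_value F S\<^sub>1"
    using Suc
    by (simp add: split_def integrable_measure_pmf_finite finite_set_process_pmf algebra_simps)
  finally show ?case .
qed auto

lemma expectation_cost_to_go:
  "measure_pmf.expectation (process_pmf p q \<pi> S\<^sub>1 T)
     (\<lambda>(h, S). (\<Sum>(S, a)\<leftarrow>h. cost p q c S a) + rel_value F S)
   = expected_total_cost p q c \<pi> S\<^sub>1 T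
     + measure_pmf.expectation (process_pmf p q \<pi> S\<^sub>1 T) (\<lambda>(h, S). rel_value F S)"
  unfolding expected_total_cost_def
  by (simp add: split_def integrable_measure_pmf_finite finite_set_process_pmf)

section \<open>Terminal values and passage to the long-run average\<close>

lemma rel_value_nonneg: "0 \<le> rel_value F S"
proof -
  obtain v l b where S: "S = (v, l, b)" by (cases S)
  show ?thesis unfolding S using q c F_nonneg by (cases l; cases b) auto
qed

text \<open>This transfers the uniform bound on the mean of \<open>lyapunov\<close> to the terminal
  value, which then vanishes after division by \<open>T\<close>.\<close>

lemma rel_value_le_lyapunov:
  "rel_value F S \<le> 2 / (p * q)\<^sup>2 + 2 / (p * q) + lyapunov S / (p * q)"
proof -
  obtain v l b where S: "S = (v, l, b)" by (cases S)
  define A B where "A = 2 / (p * q)\<^sup>2" and "B = 1 / (p * q)"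
  have A: "0 \<le> A" and B: "0 \<le> B" unfolding A_def B_def using p q by auto
  have F: "F b' u \<le> A + B * real u" for b' u
    using F_le[of b' u] unfolding A_def B_def by simp
  have convex: "q * F False i + (1 - q) * F False (v + 1)
      \<le> q * (A + B * i) + (1 - q) * (A + B * (v + 1))" for i
    using q F[of False i] F[of False "v + 1"] by (intro add_mono mult_left_mono) auto
  have goal: "rel_value F S \<le> A + 2 * B + B * lyapunov S"
  proof (cases l)
    case True
    then have "rel_value F S \<le> q * F False 1 + (1 - q) * F False (v + 1)"
      unfolding S by simp
    then show ?thesis using convex[of 1] B True unfolding S by (simp add: algebra_simps)
  next
    case l: False
    show ?thesis
    proof (cases b)
      case True
      have "rel_value F S \<le> q * (A + B * 2) + (1 - q) * (A + B * (v + 1))"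
        using convex[of 2] l True unfolding S by simp
      \<comment> \<open>Both summands are raised to the common bound
        \<open>A + 2 * B + B * (v + 1)\<close>, so that the weights \<open>q\<close> and
        \<open>1 - q\<close> merge.\<close>
      also have "\<dots> \<le> q * (A + 2 * B + B * (v + 1)) + (1 - q) * (A + 2 * B + B * (v + 1))"
        using q mult_nonneg_nonneg[OF B, of "real (v + 1)"] B
        by (intro add_mono[of "q * _"] mult_left_mono) auto
      finally show ?thesis using l unfolding S by (simp add: algebra_simps)
    next
      case False
      then show ?thesis using F[of False "v + 1"] l B unfolding S by (simp add: algebra_simps)
    qed
  qed
  then show ?thesis unfolding A_def B_def by simp
qed

lemma expectation_rel_value_bounded:
  "\<exists>K. \<forall>T. measure_pmf.expectation (process_pmf p q \<pi> S\<^sub>1 T) (\<lambda>(h, S). rel_value F S) \<le> K"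
proof (intro exI allI)
  fix T
  let ?P = "process_pmf p q \<pi> S\<^sub>1 T"
  let ?A = "2 / (p * q)\<^sup>2 + 2 / (p * q)"
  have "measure_pmf.expectation ?P (\<lambda>(h, S). rel_value F S)
      \<le> measure_pmf.expectation ?P (\<lambda>(h, S). ?A + lyapunov S / (p * q))"
    by (rule expectation_mono_finite[OF finite_set_process_pmf])
      (use rel_value_le_lyapunov in auto)
  also have "\<dots> = ?A + measure_pmf.expectation ?P (\<lambda>(h, S). lyapunov S) / (p * q)"
    by (simp add: split_def integrable_measure_pmf_finite finite_set_process_pmf)
  also have "\<dots> \<le> ?A + max (lyapunov S\<^sub>1) (2 / (p * q)) / (p * q)"
    using p q expectation_lyapunov_bound by (intro add_left_mono divide_right_mono) auto
  finally show "measure_pmf.expectation ?P (\<lambda>(h, S). rel_value F S)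
      \<le> ?A + max (lyapunov S\<^sub>1) (2 / (p * q)) / (p * q)" .
qed

lemma tendsto_gain: "(\<lambda>T. ereal (1 / real T * (real T * gain + K))) \<longlonglongrightarrow> ereal gain"
proof -
  have "(\<lambda>T. gain + K * (1 / real T)) \<longlonglongrightarrow> gain + K * 0"
    by (intro tendsto_intros lim_1_over_n)
  moreover have "\<forall>\<^sub>F T in sequentially. gain + K * (1 / real T) = 1 / real T * (real T * gain + K)"
    using eventually_gt_at_top[of 0] by eventually_elim (simp add: field_simps)
  ultimately show ?thesis by (auto dest: Lim_transform_eventually)
qed

text \<open>The mean terminal value is at most a constant \<open>K\<close>, so removing it from the
  lower bound costs nothing in the limit.\<close>

lemma gain_le_average_cost: "ereal gain \<le> average_cost p q c \<pi> S\<^sub>1"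
proof -
  obtain K where K: "measure_pmf.expectation (process_pmf p q \<pi> S\<^sub>1 T)
      (\<lambda>(h, S). rel_value F S) \<le> K" for T
    using expectation_rel_value_bounded by blast
  have le: "real T * gain + (rel_value F S\<^sub>1 - K) \<le> expected_total_cost p q c \<pi> S\<^sub>1 T" for T
    using cost_to_go_lower_bound[of T S\<^sub>1 \<pi>] K[of T] unfolding expectation_cost_to_go by simp
  have "ereal gain = limsup (\<lambda>T. ereal (1 / real T * (real T * gain + (rel_value F S\<^sub>1 - K))))"
    using lim_imp_Limsup[OF _ tendsto_gain] by simp
  also have "\<dots> \<le> average_cost p q c \<pi> S\<^sub>1"
    unfolding average_cost_def using le
    by (intro Limsup_mono always_eventually allI) (simp add: divide_right_mono)
  finally show ?thesis .
qed

text \<open>Dropping the nonnegative terminal value from the exact identity bounds the total cost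
  from above.\<close>

lemma average_cost_stationary_store: "average_cost p q c (stationary (store F)) S\<^sub>1 \<le> ereal gain"
proof -
  let ?\<pi> = "stationary (store F)"
  have "0 \<le> measure_pmf.expectation (process_pmf p q ?\<pi> S\<^sub>1 T) (\<lambda>(h, S). rel_value F S)" for T
    by (rule Bochner_Integration.integral_nonneg) (auto simp: rel_value_nonneg)
  then have le: "expected_total_cost p q c ?\<pi> S\<^sub>1 T \<le> real T * gain + rel_value F S\<^sub>1" for T
    using cost_to_go_stationary_store[of S\<^sub>1 T] unfolding expectation_cost_to_go
    by (smt (verit))
  have "average_cost p q c ?\<pi> S\<^sub>1
      \<le> limsup (\<lambda>T. ereal (1 / real T * (real T * gain + rel_value F S\<^sub>1)))"
    unfolding average_cost_def using le
    by (intro Limsup_mono always_eventually allI) (simp add: divide_right_mono)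
  also have "\<dots> = ereal gain"
    using lim_imp_Limsup[OF _ tendsto_gain] by simp
  finally show ?thesis .
qed

section \<open>Threshold structure of the greedy policy\<close>

text \<open>With a fresh packet, storing means that \<open>c\<close> is at most \<open>1 - q\<close>
  times \<open>F False (v + 1) - F True (v + 1)\<close>, which is nondecreasing in \<open>v\<close>;
  the buffer does not enter.\<close>

lemma store_mono:
  assumes "store F (v, l, b)" "v \<le> v'" "l \<le> l'"
  shows "store F (v', l', b')"
proof -
  \<comment> \<open>\<open>buffer_gain\<close> will be used at age \<open>v + 1\<close>, hence the
    shift by 2.\<close>
  have "F False (v + 2) \<le> F False (v' + 2)"
    using monoD[OF mono_F, of "v + 2" "v' + 2"] assms(2) by simp
  then have "F False (v + 1) - F True (v + 1) \<le> F False (v' + 1) - F True (v' + 1)"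
    unfolding buffer_gain using p q by (intro mult_left_mono) auto
  then have "(1 - q) * (F False (v + 1) - F True (v + 1))
      \<le> (1 - q) * (F False (v' + 1) - F True (v' + 1))"
    using q by (intro mult_left_mono) auto
  then show ?thesis using assms by (auto simp: store_def algebra_simps)
qed

lemma switching_type_store: "switching_type (stationary (store F))"
  unfolding switching_type_def using store_mono by blast

end

theorem lemma4:
  fixes p q c :: real and S\<^sub>1 :: state
  assumes "0 < p" "p < 1" and "0 < q" "q < 1" and "0 \<le> c"
    and "S\<^sub>1 \<in> state_space" and "fst S\<^sub>1 = 1"
  shows "\<exists>\<pi>. switching_type \<pi> \<and> optimal_policy p q c S\<^sub>1 \<pi>"
proof -
  interpret storage_mdp p q c using assms by unfold_locales
  obtain F where F: "\<And>b v. bellman F b v = F b v" "\<And>b. mono (F b)" "\<And>b v. 0 \<le> F b v"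
    "\<And>b v. F b v \<le> 2 / (p * q)\<^sup>2 + real v / (p * q)"
    by (rule bellman_fixed_point) blast
  interpret bellman_solution p q c F using F by unfold_locales
  have "optimal_policy p q c S\<^sub>1 (stationary (store F))"
    unfolding optimal_policy_def
    using average_cost_stationary_store gain_le_average_cost order_trans by blast
  then show ?thesis using switching_type_store by blast
qed

end
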